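(* Let $m>p$, let $C\in\mathbb{R}^{p\times m}$ have full row rank $p$, and let $S_1\in\mathbb{R}^{m\times m}$ be symmetric positive definite. Let $S_2=CS_1^{-1}C^T$ and define $\widehat{S}_2$ by $$\widehat{S}_2^{-1}=(CC^T)^{-1}\,C S_1 C^T\,(CC^T)^{-1}.$$ Then all eigenvalues of $\widehat{S}_2^{-1}S_2$ (equivalently, all generalized eigenvalues $\mu$ of $S_2z=\mu\,\widehat{S}_2z$) are real and bounded below by $1$.
   Context: This is the BFBt approximation $\widehat{S}_2$ of the nested Schur complement $S_2$ of a double saddle-point matrix $\begin{bmatrix} A & B^T & 0\\ B & -D & C^T\\ 0 & C & 0\end{bmatrix}$, where $S_1=D+BA^{-1}B^T$; the claim involves only $S_1$ and $C$. *)

theory Defs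
  imports "HOL-Analysis.Analysis"
begin

definition symmetric_pos_def :: "real^'n^'n \<Rightarrow> bool" where
  "symmetric_pos_def A \<longleftrightarrow> transpose A = A \<and> (\<forall>x. x \<noteq> 0 \<longrightarrow> x \<bullet> (A *v x) > 0)"

definition is_eigenvalue :: "'a::field^'n^'n \<Rightarrow> 'a \<Rightarrow> bool" where
  "is_eigenvalue A \<mu> \<longleftrightarrow> (\<exists>z. z \<noteq> 0 \<and> A *v z = \<mu> *s z)"

definition is_gen_eigenvalue :: "'a::field^'n^'n \<Rightarrow> 'a^'n^'n \<Rightarrow> 'a \<Rightarrow> bool" where
  "is_gen_eigenvalue A B \<mu> \<longleftrightarrow> (\<exists>z. z \<noteq> 0 \<and> A *v z = \<mu> *s (B *v z))"

(* Eigenvalues of real matrices are taken over the complex numbers, so that their being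
   real is a genuine assertion. *)
definition complex_matrix :: "real^'n^'m \<Rightarrow> complex^'n^'m" where
  "complex_matrix A = (\<chi> i j. complex_of_real (A $ i $ j))"

definition schur2 :: "real^'m^'p \<Rightarrow> real^'m^'m \<Rightarrow> real^'p^'p" where
  "schur2 C S1 = C ** matrix_inv S1 ** transpose C"

definition bfbt_inverse :: "real^'m^'p \<Rightarrow> real^'m^'m \<Rightarrow> real^'p^'p" where
  "bfbt_inverse C S1 =
     matrix_inv (C ** transpose C) ** (C ** S1 ** transpose C) ** matrix_inv (C ** transpose C)"

(* The approximation is specified through its inverse. As matrix_inv is unspecified on singular
   matrices, recovering bfbt_inverse as matrix_inv of this matrix needs its invertibility. *)
definition bfbt :: "real^'m^'p \<Rightarrow> real^'m^'m \<Rightarrow> real^'p^'p" where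
  "bfbt C S1 = matrix_inv (bfbt_inverse C S1)"

end

theory Submission
  imports Defs
begin

text \<open>Congruence makes both \<^term>\<open>schur2 C S1\<close> and the preconditioner symmetric positive definite, so
  a generalized eigenvector forces the eigenvalue to be a quotient of positive quadratic forms.
  That quotient is at least one: writing \<open>u = C\<^sup>T v\<close>, \<open>t = S\<^sub>1\<inverse> u\<close> and \<open>q = C\<^sup>T w\<close>, where \<open>w\<close> solves
  \<open>C S\<^sub>1 C\<^sup>T w = C C\<^sup>T v\<close>, the difference of the two forms at \<open>v\<close> is
  \<open>(t - q) \<bullet> S\<^sub>1 (t - q) \<ge> 0\<close>.\<close>

section \<open>Transposes and matrix inverses\<close>

lemma inner_matrix_transpose:
  fixes A :: "real^'n^'m"
  shows "x \<bullet> (A *v y) = (transpose A *v x) \<bullet> y"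
  by (simp add: dot_lmul_matrix)

lemma inner_symmetric_matrix:
  fixes A :: "real^'n^'n"
  assumes "transpose A = A"
  shows "x \<bullet> (A *v y) = y \<bullet> (A *v x)"
  using inner_matrix_transpose[of x A y] assms by (simp add: inner_commute)

lemma
  fixes A :: "'a::semiring_1^'n^'m"
  assumes "invertible A"
  shows matrix_inv_right: "A ** matrix_inv A = mat 1"
    and matrix_inv_left: "matrix_inv A ** A = mat 1"
proof -
  have "A ** matrix_inv A = mat 1 \<and> matrix_inv A ** A = mat 1"
    using assms unfolding invertible_def matrix_inv_def by (rule someI_ex)
  thus "A ** matrix_inv A = mat 1" "matrix_inv A ** A = mat 1"
    by simp_all
qed

text \<open>Over a field a one-sided inverse of a square matrix is two-sided, and two-sided inverses
  are unique.\<close>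

lemma matrix_inv_eqI:
  fixes A :: "'a::field^'n^'n"
  assumes "A ** B = mat 1"
  shows "matrix_inv A = B"
proof -
  have BA: "B ** A = mat 1"
    using assms by (simp add: matrix_left_right_inverse)
  hence "invertible A"
    using assms by (auto simp: invertible_def)
  hence "matrix_inv A ** A = mat 1"
    by (simp add: matrix_inv_left)
  thus ?thesis
    by (metis assms matrix_mul_assoc matrix_mul_lid matrix_mul_rid)
qed

lemma matrix_inv_matrix_inv:
  fixes A :: "'a::field^'n^'n"
  assumes "invertible A"
  shows "matrix_inv (matrix_inv A) = A"
  by (rule matrix_inv_eqI) (rule matrix_inv_left[OF assms])

lemma transpose_matrix_inv_symmetric:
  fixes A :: "'a::field^'n^'n"
  assumes "invertible A" "transpose A = A"
  shows "transpose (matrix_inv A) = matrix_inv A"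
proof -
  have "transpose (matrix_inv A ** A) = mat 1"
    using assms by (simp add: matrix_inv_left transpose_mat)
  hence "A ** transpose (matrix_inv A) = mat 1"
    by (simp add: matrix_transpose_mul assms(2))
  thus ?thesis
    by (metis matrix_inv_eqI)
qed

section \<open>Symmetric positive definite matrices\<close>

lemma symmetric_pos_def_invertible:
  assumes "symmetric_pos_def A"
  shows "invertible A"
proof -
  have "\<forall>x. A *v x = 0 \<longrightarrow> x = 0"
    using assms unfolding symmetric_pos_def_def by (metis inner_zero_right less_irrefl)
  thus ?thesis
    by (simp add: invertible_left_inverse matrix_left_invertible_ker)
qed

lemma symmetric_pos_def_nonneg:
  assumes "symmetric_pos_def A"
  shows "0 \<le> x \<bullet> (A *v x)"
  using assms unfolding symmetric_pos_def_def by (cases "x = 0") (auto intro: less_imp_le)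

text \<open>The form at \<open>x\<close> is the form of \<open>A\<close> at
  \<open>transpose B *v x\<close>, which is nonzero by injectivity. All positivity of composite
  matrices below comes from this.\<close>

lemma symmetric_pos_def_congruence:
  fixes B :: "real^'m^'p"
  assumes "symmetric_pos_def A" and inj: "\<And>x. transpose B *v x = 0 \<Longrightarrow> x = 0"
  shows "symmetric_pos_def (B ** A ** transpose B)"
  unfolding symmetric_pos_def_def
proof (intro conjI allI impI)
  show "transpose (B ** A ** transpose B) = B ** A ** transpose B"
    using assms(1) by (simp add: symmetric_pos_def_def matrix_transpose_mul matrix_mul_assoc)
next
  fix x :: "real^'p" assume "x \<noteq> 0"
  hence "transpose B *v x \<noteq> 0"
    using inj by blast
  hence "0 < (transpose B *v x) \<bullet> (A *v (transpose B *v x))"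
    using assms(1) by (simp add: symmetric_pos_def_def)
  also have "\<dots> = x \<bullet> (B ** A ** transpose B *v x)"
    by (simp add: inner_matrix_transpose flip: matrix_vector_mul_assoc)
  finally show "0 < x \<bullet> (B ** A ** transpose B *v x)" .
qed

lemma symmetric_pos_def_matrix_inv:
  assumes "symmetric_pos_def A"
  shows "symmetric_pos_def (matrix_inv A)"
proof -
  let ?I = "matrix_inv A"
  have inv: "invertible A"
    using assms by (rule symmetric_pos_def_invertible)
  have sym: "transpose ?I = ?I"
    using inv assms by (simp add: transpose_matrix_inv_symmetric symmetric_pos_def_def)
  \<comment> \<open>By symmetry of \<open>?I\<close> this product is \<open>?I\<close> itself, so
    the inverse is congruent to \<open>A\<close>.\<close>
  have "symmetric_pos_def (?I ** A ** transpose ?I)"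
  proof (rule symmetric_pos_def_congruence[OF assms])
    fix x assume "transpose ?I *v x = 0"
    hence "A *v (?I *v x) = 0"
      by (simp add: sym)
    thus "x = 0"
      by (simp add: matrix_vector_mul_assoc matrix_inv_right[OF inv])
  qed
  thus ?thesis
    by (simp add: sym matrix_inv_left[OF inv])
qed

lemma symmetric_pos_def_mat_1: "symmetric_pos_def (mat 1 :: real^'n^'n)"
  by (simp add: symmetric_pos_def_def transpose_mat)

text \<open>Transposing turns full row rank into full column rank, which is injectivity; congruence
  by \<open>C\<close> needs it in this form.\<close>

lemma full_row_rank_transpose_ker:
  fixes C :: "real^'m^'p"
  assumes "rank C = CARD('p)" "transpose C *v x = 0"
  shows "x = 0"
proof -
  have "inj ((*v) (transpose C))"
    using assms(1) by (simp add: rank_transpose flip: full_rank_injective)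
  thus ?thesis
    using assms(2) by (metis injD matrix_vector_mult_0_right)
qed

section \<open>Real and imaginary parts of complex vectors\<close>

definition Re_vec :: "complex^'n \<Rightarrow> real^'n" where
  "Re_vec z = (\<chi> i. Re (z $ i))"

definition Im_vec :: "complex^'n \<Rightarrow> real^'n" where
  "Im_vec z = (\<chi> i. Im (z $ i))"

lemma complex_vec_eq_iff: "z = w \<longleftrightarrow> Re_vec z = Re_vec w \<and> Im_vec z = Im_vec w"
  by (auto simp: Re_vec_def Im_vec_def vec_eq_iff complex_eq_iff)

lemma Re_Im_vec_zero [simp]: "Re_vec 0 = 0" "Im_vec 0 = 0"
  by (simp_all add: Re_vec_def Im_vec_def vec_eq_iff)

text \<open>A real matrix does not mix real and imaginary parts, so a complex eigenvector equation
  splits into two real ones.\<close>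

lemma Re_Im_vec_complex_matrix:
  "Re_vec (complex_matrix A *v z) = A *v Re_vec z"
  "Im_vec (complex_matrix A *v z) = A *v Im_vec z"
  by (simp_all add: Re_vec_def Im_vec_def complex_matrix_def matrix_vector_mult_def vec_eq_iff)

lemma Re_Im_vec_smult:
  "Re_vec (\<mu> *s z) = Re \<mu> *\<^sub>R Re_vec z - Im \<mu> *\<^sub>R Im_vec z"
  "Im_vec (\<mu> *s z) = Re \<mu> *\<^sub>R Im_vec z + Im \<mu> *\<^sub>R Re_vec z"
  by (simp_all add: Re_vec_def Im_vec_def vec_eq_iff)

lemma complex_matrix_mult: "complex_matrix (A ** B) = complex_matrix A ** complex_matrix B"
  by (simp add: complex_matrix_def matrix_matrix_mult_def vec_eq_iff)

lemma complex_matrix_mat_1: "complex_matrix (mat 1) = mat 1"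
  by (simp add: complex_matrix_def mat_def vec_eq_iff)

section \<open>Eigenvalues and generalized eigenvalues\<close>

lemma is_eigenvalue_iff_is_gen_eigenvalue:
  fixes A B B' :: "'a::field^'n^'n"
  assumes "B ** B' = mat 1"
  shows "is_eigenvalue (B' ** A) \<mu> \<longleftrightarrow> is_gen_eigenvalue A B \<mu>"
proof -
  have "B' ** B = mat 1"
    using assms by (simp add: matrix_left_right_inverse)
  \<comment> \<open>Multiplication by \<open>B\<close> gives one direction, multiplication by
    \<open>B'\<close> the other.\<close>
  hence "(B' ** A) *v z = \<mu> *s z \<longleftrightarrow> A *v z = \<mu> *s (B *v z)" for z
    by (metis assms matrix_vector_mul_assoc matrix_vector_mul_lid vector_scalar_commute)
  thus ?thesis
    by (simp add: is_eigenvalue_def is_gen_eigenvalue_def)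
qed

lemma gen_eigenvalue_real_ge_1:
  assumes "transpose A = A" "symmetric_pos_def H"
    and le: "\<And>v. v \<bullet> (H *v v) \<le> v \<bullet> (A *v v)"
    and "is_gen_eigenvalue (complex_matrix A) (complex_matrix H) \<mu>"
  shows "\<mu> \<in> \<real> \<and> 1 \<le> Re \<mu>"
proof -
  obtain z where "z \<noteq> 0"
    and eq: "complex_matrix A *v z = \<mu> *s (complex_matrix H *v z)"
    using assms(4) by (auto simp: is_gen_eigenvalue_def)
  define x y where "x = Re_vec z" and "y = Im_vec z"
  have Ax: "A *v x = Re \<mu> *\<^sub>R (H *v x) - Im \<mu> *\<^sub>R (H *v y)"
    and Ay: "A *v y = Re \<mu> *\<^sub>R (H *v y) + Im \<mu> *\<^sub>R (H *v x)"
    using eq by (simp_all add: complex_vec_eq_iff Re_Im_vec_complex_matrix Re_Im_vec_smult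
        x_def y_def)
  \<comment> \<open>This is the Hermitian form \<open>z^* H z\<close> at \<open>z = x + iy\<close>;
    its cross terms cancel because \<open>H\<close> is symmetric.\<close>
  define h where "h = x \<bullet> (H *v x) + y \<bullet> (H *v y)"
  have "x \<noteq> 0 \<or> y \<noteq> 0"
    using \<open>z \<noteq> 0\<close> by (auto simp: complex_vec_eq_iff x_def y_def)
  hence "0 < h"
    using assms(2) symmetric_pos_def_nonneg[OF assms(2)]
    unfolding h_def symmetric_pos_def_def by (metis add_pos_nonneg add_nonneg_pos)
  have Hxy: "y \<bullet> (H *v x) = x \<bullet> (H *v y)"
    using assms(2) by (intro inner_symmetric_matrix) (simp add: symmetric_pos_def_def)
  \<comment> \<open>Imaginary part of \<open>z^* A z = \<mu> z^* H z\<close>; the left side vanishes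
    by symmetry of \<open>A\<close>.\<close>
  have "x \<bullet> (A *v y) - y \<bullet> (A *v x) = Im \<mu> * h"
    by (simp add: Ax Ay h_def inner_add_right inner_diff_right Hxy algebra_simps)
  hence "Im \<mu> = 0"
    using inner_symmetric_matrix[OF assms(1), of x y] \<open>0 < h\<close> by simp
  \<comment> \<open>Real part of the same identity.\<close>
  have "x \<bullet> (A *v x) + y \<bullet> (A *v y) = Re \<mu> * h"
    by (simp add: Ax Ay h_def inner_add_right inner_diff_right Hxy algebra_simps)
  moreover have "h \<le> x \<bullet> (A *v x) + y \<bullet> (A *v y)"
    unfolding h_def by (intro add_mono le)
  ultimately have "1 * h \<le> Re \<mu> * h"
    by simp
  hence "1 \<le> Re \<mu>"
    using \<open>0 < h\<close> by (rule mult_right_le_imp_le)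
  thus ?thesis
    using \<open>Im \<mu> = 0\<close> by (simp add: complex_is_Real_iff)
qed

section \<open>Comparison of the Schur complement with its BFBt approximation\<close>

context
  fixes C :: "real^'m^'p" and S1 :: "real^'m^'m"
  assumes full_rank: "rank C = CARD('p)" and S1: "symmetric_pos_def S1"
begin

lemma symmetric_pos_def_gram: "symmetric_pos_def (C ** transpose C)"
  using symmetric_pos_def_congruence[OF symmetric_pos_def_mat_1 full_row_rank_transpose_ker[OF full_rank]]
  by simp

lemma symmetric_pos_def_schur2: "symmetric_pos_def (schur2 C S1)"
  unfolding schur2_def
  by (intro symmetric_pos_def_congruence symmetric_pos_def_matrix_inv S1)
    (rule full_row_rank_transpose_ker[OF full_rank])

lemma symmetric_pos_def_bfbt_inverse: "symmetric_pos_def (bfbt_inverse C S1)"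
proof -
  let ?I = "matrix_inv (C ** transpose C)"
  have I: "symmetric_pos_def ?I"
    by (intro symmetric_pos_def_matrix_inv symmetric_pos_def_gram)
  hence sym: "transpose ?I = ?I"
    by (simp add: symmetric_pos_def_def)
  \<comment> \<open>Two nested congruences, by \<open>C\<close> and then by the symmetric
    \<open>?I\<close>.\<close>
  have "symmetric_pos_def (?I ** (C ** S1 ** transpose C) ** transpose ?I)"
  proof (intro symmetric_pos_def_congruence S1)
    show "x = 0" if "transpose ?I *v x = 0" for x
      using symmetric_pos_def_invertible[OF I] that
      by (simp add: sym invertible_left_inverse matrix_left_invertible_ker)
  qed (rule full_row_rank_transpose_ker[OF full_rank])
  thus ?thesis
    by (simp add: bfbt_inverse_def sym)
qed

text \<open>In the \<open>S1\<close> inner product, \<open>q\<close> is the orthogonal projection of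
  \<open>t\<close> onto the range of \<open>transpose C\<close>. The two forms are the squared
  \<open>S1\<close> norms of \<open>q\<close> and \<open>t\<close>, so the gap is that of
  \<open>t - q\<close> by Pythagoras.\<close>

lemma bfbt_quadratic_form_le: "v \<bullet> (bfbt C S1 *v v) \<le> v \<bullet> (schur2 C S1 *v v)"
proof -
  let ?G = "C ** transpose C"
  have GI: "?G ** matrix_inv ?G = mat 1"
    by (intro matrix_inv_right symmetric_pos_def_invertible symmetric_pos_def_gram)
  have PI: "bfbt_inverse C S1 ** bfbt C S1 = mat 1"
    unfolding bfbt_def
    by (intro matrix_inv_right symmetric_pos_def_invertible symmetric_pos_def_bfbt_inverse)
  have SI: "S1 ** matrix_inv S1 = mat 1"
    by (intro matrix_inv_right symmetric_pos_def_invertible S1)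
  have sym: "transpose S1 = S1"
    using S1 by (simp add: symmetric_pos_def_def)
  \<comment> \<open>Since \<open>bfbt C S1\<close> is \<open>?G (C S1 C^T)^{-1} ?G\<close>, this is
    \<open>(C S1 C^T)^{-1} ?G v\<close>, written without inverting \<open>C S1 C^T\<close>
    separately.\<close>
  define w where "w = matrix_inv ?G *v (bfbt C S1 *v v)"
  define u t q where "u = transpose C *v v" and "t = matrix_inv S1 *v u"
    and "q = transpose C *v w"
  have Gw: "?G *v w = bfbt C S1 *v v"
    unfolding w_def by (metis GI matrix_vector_mul_assoc matrix_vector_mul_lid)
  have "v = bfbt_inverse C S1 *v (bfbt C S1 *v v)"
    by (simp add: matrix_vector_mul_assoc PI)
  also have "\<dots> = matrix_inv ?G *v (C *v (S1 *v q))"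
    by (simp add: bfbt_inverse_def w_def q_def matrix_vector_mul_assoc matrix_mul_assoc)
  finally have "?G *v v = C *v (S1 *v q)"
    by (metis GI matrix_vector_mul_assoc matrix_vector_mul_lid)
  \<comment> \<open>As \<open>u = S1 *v t\<close>, this is the orthogonality relation
    \<open>C S1 (t - q) = 0\<close>.\<close>
  hence Cu: "C *v u = C *v (S1 *v q)"
    unfolding u_def by (metis matrix_vector_mul_assoc)
  have S1t: "S1 *v t = u"
    by (simp add: t_def matrix_vector_mul_assoc SI)
  have H: "v \<bullet> (bfbt C S1 *v v) = q \<bullet> u"
    by (simp add: Gw[symmetric] q_def u_def inner_matrix_transpose inner_commute
        flip: matrix_vector_mul_assoc)
  have "q \<bullet> u = w \<bullet> (C *v u)"
    by (simp add: q_def inner_matrix_transpose)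
  also have "\<dots> = q \<bullet> (S1 *v q)"
    unfolding Cu by (simp add: q_def inner_matrix_transpose)
  finally have qq: "q \<bullet> (S1 *v q) = q \<bullet> u" ..
  have tq: "t \<bullet> (S1 *v q) = q \<bullet> u"
    using inner_symmetric_matrix[OF sym, of t q] by (simp add: S1t)
  have A: "v \<bullet> (schur2 C S1 *v v) = t \<bullet> u"
    by (simp add: schur2_def t_def u_def inner_matrix_transpose inner_commute
        flip: matrix_vector_mul_assoc)
  have "0 \<le> (t - q) \<bullet> (S1 *v (t - q))"
    by (rule symmetric_pos_def_nonneg[OF S1])
  \<comment> \<open>Both mixed terms and the square of \<open>q\<close> equal
    \<open>q \<bullet> u\<close>, so one copy survives with a minus sign.\<close>
  also have "\<dots> = t \<bullet> u - q \<bullet> u"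
    by (simp add: matrix_vector_mult_diff_distrib inner_diff_left inner_diff_right S1t qq tq)
  finally show ?thesis
    by (simp add: H A)
qed

end

section \<open>Spectrum of the preconditioned Schur complement\<close>

theorem mainTheorem3:
  fixes C :: "real^'m^'p" and S1 :: "real^'m^'m"
  assumes "CARD('m) > CARD('p)"
    and "rank C = CARD('p)"
    and "symmetric_pos_def S1"
  shows "invertible (bfbt C S1) \<and> matrix_inv (bfbt C S1) = bfbt_inverse C S1 \<and>
    (\<forall>\<mu>::complex.
       (is_eigenvalue (complex_matrix (matrix_inv (bfbt C S1) ** schur2 C S1)) \<mu> \<longleftrightarrow>
        is_gen_eigenvalue (complex_matrix (schur2 C S1)) (complex_matrix (bfbt C S1)) \<mu>) \<and>
       (is_eigenvalue (complex_matrix (matrix_inv (bfbt C S1) ** schur2 C S1)) \<mu> \<longrightarrow>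
        \<mu> \<in> \<real> \<and> 1 \<le> Re \<mu>))"
proof -
  note P = symmetric_pos_def_bfbt_inverse[OF assms(2,3)]
  have H: "symmetric_pos_def (bfbt C S1)"
    unfolding bfbt_def by (rule symmetric_pos_def_matrix_inv[OF P])
  hence inv: "invertible (bfbt C S1)"
    by (rule symmetric_pos_def_invertible)
  have eq: "matrix_inv (bfbt C S1) = bfbt_inverse C S1"
    unfolding bfbt_def by (rule matrix_inv_matrix_inv[OF symmetric_pos_def_invertible[OF P]])
  \<comment> \<open>The embedding is multiplicative and preserves the identity, so the real inverse
    remains an inverse over the complex numbers.\<close>
  have "complex_matrix (bfbt C S1) ** complex_matrix (matrix_inv (bfbt C S1)) = mat 1"
    by (simp add: matrix_inv_right[OF inv] complex_matrix_mat_1 flip: complex_matrix_mult)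
  note iff = is_eigenvalue_iff_is_gen_eigenvalue[OF this,
      of "complex_matrix (schur2 C S1)", folded complex_matrix_mult]
  have "transpose (schur2 C S1) = schur2 C S1"
    using symmetric_pos_def_schur2[OF assms(2,3)] by (simp add: symmetric_pos_def_def)
  note bound = gen_eigenvalue_real_ge_1[OF this H bfbt_quadratic_form_le[OF assms(2,3)]]
  show ?thesis
    using inv eq iff bound by blast
qed

end
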